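(* Let $n$ be a positive integer. For all integers $k\in\{0,1,\dots,n\}$ and $l\in\{1,2,\dots,n\}$, $$\int_0^1\frac{{\mathscr T}_{nk}(x)\,{\mathscr T}_{nl}(x)}{x\sqrt{x(1-x)}}\,dx=\frac{1}{2(k+l)-1}\,\frac{(2n-k-l)!!}{(2n-k-l-1)!!}\,\frac{(2n+k+l-1)!!}{(2n+k+l-2)!!}\,\pi\,\delta_{kl},$$ and for all $k\in\{1,2,\dots,n\}$, $$\int_0^1\frac{{\mathscr T}_{nk}(x)}{x\sqrt{x(1-x)}}\,dx=\frac{(2k-3)!!}{(2k)!!}\,2n\pi .$$
   Context: For integers $0\le k\le n$ and real $\alpha,\beta$, put $${\cal P}_{nk}^{(\alpha,\beta)}(x)=\frac{x^{-\alpha-k-1}(1-x)^{-\beta}}{(n-k)!}\frac{d^{\,n-k}}{dx^{\,n-k}}\left(x^{\alpha+n+k+1}(1-x)^{\beta+n-k}\right),\qquad 0<x<1,$$ which is (the restriction of) a polynomial in $x$. The T-kind orthogonal polynomials are $${\mathscr T}_{nk}(x)=c_{nk}\,{\cal P}_{nk}^{(-\frac32,-\frac12)}(x),\qquad c_{nk}=\frac{(n-k)!}{(n-k-\frac12)_{n-k}},\qquad 0\le k\le n,$$ where $(a)_m=a(a-1)\cdots(a-m+1)$ is the falling factorial, with $(a)_0=1$. Double factorials use the conventions $0!!=(-1)!!=1$, and $\delta_{kl}$ is the Kronecker delta. *)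

theory Defs
  imports "HOL-Analysis.Analysis"
begin

text \<open>The falling factorial \<open>(a)\<^sub>m = a (a - 1) \<dots> (a - m + 1)\<close>; the library's
  \<^const>\<open>pochhammer\<close> is the rising one.\<close>

definition falling_fact :: "real \<Rightarrow> nat \<Rightarrow> real" where
  "falling_fact a m = (\<Prod>i<m. a - real i)"

text \<open>Double factorial on integers, so that \<open>(-1)!!\<close> makes sense. The value \<open>1\<close> at arguments
  below \<open>-1\<close> is a dummy.\<close>

function double_fact :: "int \<Rightarrow> real" where
  "double_fact m = (if m \<le> 0 then 1 else of_int m * double_fact (m - 2))"
  by auto
termination by (relation "Wellfounded.measure nat") auto

declare double_fact.simps [simp del]

text \<open>The functions \<open>\<P>\<^sub>n\<^sub>k\<close>, \<open>\<T>\<^sub>n\<^sub>k\<close> below are meaningful for \<open>k \<le> n\<close> and \<open>0 < x < 1\<close> only.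
  At such \<open>x\<close> the differentiated function is smooth in a neighbourhood, so that the iterated
  \<^const>\<open>deriv\<close> is the usual higher derivative.\<close>

definition P_poly :: "real \<Rightarrow> real \<Rightarrow> nat \<Rightarrow> nat \<Rightarrow> real \<Rightarrow> real" where
  "P_poly \<alpha> \<beta> n k x =
     x powr (- \<alpha> - real k - 1) * (1 - x) powr (- \<beta>) / fact (n - k) *
     (deriv ^^ (n - k))
       (\<lambda>t. t powr (\<alpha> + real n + real k + 1) * (1 - t) powr (\<beta> + real n - real k)) x"

definition T_coeff :: "nat \<Rightarrow> nat \<Rightarrow> real" where
  "T_coeff n k = fact (n - k) / falling_fact (real n - real k - 1 / 2) (n - k)"

definition T_poly :: "nat \<Rightarrow> nat \<Rightarrow> real \<Rightarrow> real" where
  "T_poly n k x = T_coeff n k * P_poly (- 3 / 2) (- 1 / 2) n k x"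

end

theory Submission
  imports Defs
begin

text \<open>By Leibniz' rule, \<open>\<T>\<^sub>n\<^sub>k\<close> is \<open>x\<^sup>k\<close> times a Jacobi polynomial of degree \<open>n - k\<close>,
  written in the basis \<open>x\<^sup>j (1 - x)\<^sup>n\<^sup>-\<^sup>k\<^sup>-\<^sup>j\<close>. Integrating termwise with the Beta function and summing by
  Vandermonde's identity, the integral of \<open>\<T>\<^sub>n\<^sub>k x\<^sup>i\<close> against the weight is a multiple of
  \<open>n - i\<close> choose \<open>n - k\<close>. This vanishes for \<open>i > k\<close>, and \<open>\<T>\<^sub>n\<^sub>l\<close> only contains the powers
  \<open>x\<^sup>l, \<dots>, x\<^sup>n\<close>; so for \<open>k \<le> l\<close> only the lowest power, with \<open>k = l\<close>, contributes. The second
  integral is the case \<open>i = 0\<close>.\<close>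

section \<open>Shifted Jacobi polynomials and Rodrigues' formula\<close>

text \<open>The Jacobi polynomial P_m^(a,b) at 1 - 2x. In this form each term, times powers of
  \<open>x\<close> and \<open>1 - x\<close>, is a Beta integrand.\<close>

definition sjacobi :: "real \<Rightarrow> real \<Rightarrow> nat \<Rightarrow> real poly" where
  "sjacobi a b m = (\<Sum>j\<le>m. smult ((- 1) ^ j * ((a + real m) gchoose (m - j)) * ((b + real m) gchoose j))
     ([:0, 1:] ^ j * [:1, - 1:] ^ (m - j)))"

lemma poly_sjacobi:
  "poly (sjacobi a b m) x = (\<Sum>j\<le>m. (- 1) ^ j * ((a + real m) gchoose (m - j)) *
     ((b + real m) gchoose j) * (x ^ j * (1 - x) ^ (m - j)))"
  by (simp add: sjacobi_def poly_sum)

lemma degree_sjacobi: "degree (sjacobi a b m) \<le> m"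
  unfolding sjacobi_def
proof (rule degree_sum_le)
  fix j assume "j \<in> {..m}"
  have "degree ([:0, 1:] ^ j * [:1, - 1:] ^ (m - j) :: real poly) \<le> 1 * j + 1 * (m - j)"
    by (intro order.trans[OF degree_mult_le] add_mono order.trans[OF degree_power_le]) auto
  thus "degree (smult ((- 1) ^ j * ((a + real m) gchoose (m - j)) * ((b + real m) gchoose j))
      ([:0, 1:] ^ j * [:1, - 1:] ^ (m - j))) \<le> m"
    using \<open>j \<in> {..m}\<close> by (intro order.trans[OF degree_smult_le]) auto
qed auto

text \<open>At \<open>x = 0\<close> only the term \<open>j = 0\<close> survives. No other
  coefficient enters the norm.\<close>

lemma coeff_0_sjacobi: "coeff (sjacobi a b m) 0 = (a + real m) gchoose m"
proof -
  have "coeff (sjacobi a b m) 0 = (\<Sum>j\<le>m. if j = 0 then (a + real m) gchoose m else 0)"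
    unfolding poly_0_coeff_0[symmetric] poly_sjacobi by (intro sum.cong) auto
  thus ?thesis by simp
qed

text \<open>Both factors come with sequences of successive derivatives, so that closed forms can be
  inserted directly. The induction collects terms by Pascal's rule.\<close>

lemma general_Leibniz_deriv:
  fixes u v :: "nat \<Rightarrow> real \<Rightarrow> real"
  assumes "open S" "x \<in> S"
    and u: "\<And>i x. x \<in> S \<Longrightarrow> (u i has_real_derivative u (Suc i) x) (at x)"
    and v: "\<And>i x. x \<in> S \<Longrightarrow> (v i has_real_derivative v (Suc i) x) (at x)"
  shows "(deriv ^^ m) (\<lambda>x. u 0 x * v 0 x) x = (\<Sum>j\<le>m. real (m choose j) * u (m - j) x * v j x)"
  using \<open>x \<in> S\<close>
proof (induction m arbitrary: x)
  case 0
  show ?case by simp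
next
  case (Suc m)
  \<comment> \<open>The induction hypothesis holds on the whole open set \<open>S\<close>, hence
    near \<open>x\<close>, and may be differentiated.\<close>
  have "(deriv ^^ Suc m) (\<lambda>x. u 0 x * v 0 x) x =
      deriv (\<lambda>x. \<Sum>j\<le>m. real (m choose j) * u (m - j) x * v j x) x"
    using Suc \<open>open S\<close> by (auto intro!: deriv_cong_ev eventually_nhds_in_open[THEN eventually_mono, of S])
  also have "\<dots> = (\<Sum>j\<le>m. real (m choose j) * (u (Suc m - j) x * v j x + u (m - j) x * v (Suc j) x))"
    using Suc.prems
    by (intro DERIV_imp_deriv) (auto intro!: derivative_eq_intros u v sum.cong simp: algebra_simps Suc_diff_le)
  also have "\<dots> = (\<Sum>j\<le>m. real (m choose j) * u (Suc m - j) x * v j x) +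
      (\<Sum>j\<le>m. real (m choose j) * u (Suc m - Suc j) x * v (Suc j) x)"
    by (simp add: algebra_simps sum.distrib)
  \<comment> \<open>The added term \<open>j = Suc m\<close> vanishes since
    \<open>m choose Suc m = 0\<close>; splitting off \<open>j = 0\<close> then aligns this sum with
    the other one.\<close>
  also have "(\<Sum>j\<le>m. real (m choose j) * u (Suc m - j) x * v j x) =
      (\<Sum>j\<le>Suc m. real (m choose j) * u (Suc m - j) x * v j x)"
    by simp
  also have "\<dots> = u (Suc m) x * v 0 x + (\<Sum>j\<le>m. real (m choose Suc j) * u (Suc m - Suc j) x * v (Suc j) x)"
    by (subst sum.atMost_Suc_shift) simp
  also have "\<dots> + (\<Sum>j\<le>m. real (m choose j) * u (Suc m - Suc j) x * v (Suc j) x) =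
      u (Suc m) x * v 0 x + (\<Sum>j\<le>m. real (Suc m choose Suc j) * u (Suc m - Suc j) x * v (Suc j) x)"
    by (simp add: algebra_simps sum.distrib)
  also have "\<dots> = (\<Sum>j\<le>Suc m. real (Suc m choose j) * u (Suc m - j) x * v j x)"
    by (subst sum.atMost_Suc_shift) simp
  finally show ?case .
qed

lemma falling_fact_gbinomial: "falling_fact a m = fact m * (a gchoose m)"
  by (simp add: falling_fact_def gbinomial_mult_fact lessThan_atLeast0)

lemma falling_fact_Suc: "falling_fact a (Suc m) = falling_fact a m * (a - real m)"
  by (simp add: falling_fact_def)

text \<open>Leibniz' rule produces falling factorials of the two exponents; with the binomial
  coefficient and the division by \<open>fact (n - k)\<close> they become generalized binomials. The
  first parameter comes from writing the exponent of \<open>t\<close> as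
  \<open>(\<alpha> + 2 * k + 1) + (n - k)\<close>.\<close>

lemma P_poly_eq_sjacobi:
  assumes "k \<le> n" "0 < x" "x < 1"
  shows "P_poly \<alpha> \<beta> n k x = x ^ k * poly (sjacobi (\<alpha> + 2 * real k + 1) \<beta> (n - k)) x"
proof -
  define m A B where "m = n - k" and "A = \<alpha> + real n + real k + 1" and "B = \<beta> + real n - real k"
  \<comment> \<open>Closed forms of all derivatives of the two factors; the sign in \<open>v\<close>
    comes from the inner function \<open>1 - t\<close>.\<close>
  define u where "u = (\<lambda>i t. falling_fact A i * t powr (A - real i))"
  define v where "v = (\<lambda>j t. (- 1) ^ j * falling_fact B j * (1 - t) powr (B - real j))"
  have AB: "\<alpha> + 2 * real k + 1 + real m = A" "\<beta> + real m = B"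
    using assms by (auto simp: A_def B_def m_def of_nat_diff)
  have "(deriv ^^ m) (\<lambda>t. t powr A * (1 - t) powr B) x = (deriv ^^ m) (\<lambda>t. u 0 t * v 0 t) x"
    by (simp add: u_def v_def falling_fact_def)
  also have "\<dots> = (\<Sum>j\<le>m. real (m choose j) * u (m - j) x * v j x)"
  proof (rule general_Leibniz_deriv)
    show "open {0<..<1::real}" "x \<in> {0<..<1}" using assms by auto
    fix i and t :: real assume t: "t \<in> {0<..<1}"
    show "(u i has_real_derivative u (Suc i) t) (at t)"
      unfolding u_def using t by (auto intro!: derivative_eq_intros simp: falling_fact_Suc diff_diff_eq algebra_simps)
    show "(v i has_real_derivative v (Suc i) t) (at t)"
      unfolding v_def using t by (auto intro!: derivative_eq_intros simp: falling_fact_Suc diff_diff_eq algebra_simps)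
  qed
  finally have D: "(deriv ^^ m) (\<lambda>t. t powr A * (1 - t) powr B) x =
      (\<Sum>j\<le>m. real (m choose j) * u (m - j) x * v j x)" .
  have "P_poly \<alpha> \<beta> n k x =
      (\<Sum>j\<le>m. x powr (- \<alpha> - real k - 1) * (1 - x) powr (- \<beta>) / fact m * (real (m choose j) * u (m - j) x * v j x))"
    unfolding P_poly_def m_def[symmetric] A_def[symmetric] B_def[symmetric] D by (simp add: sum_distrib_left)
  also have "\<dots> = (\<Sum>j\<le>m. x ^ k * ((- 1) ^ j * (A gchoose (m - j)) * (B gchoose j) * (x ^ j * (1 - x) ^ (m - j))))"
  proof (rule sum.cong)
    fix j assume j: "j \<in> {..m}"
    \<comment> \<open>The prefactor removes \<alpha> and \<beta> from the exponents, which leaves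
      the natural powers \<open>k + j\<close> and \<open>m - j\<close>.\<close>
    have "A - real (m - j) = (\<alpha> + real k + 1) + real (k + j)"
      using j assms by (simp add: A_def m_def of_nat_diff)
    hence p1: "x powr (- \<alpha> - real k - 1) * x powr (A - real (m - j)) = x ^ k * x ^ j"
      using assms by (simp add: powr_add[symmetric] powr_realpow[symmetric])
    have "B - real j = \<beta> + real (m - j)"
      using j assms by (simp add: B_def m_def of_nat_diff)
    hence p2: "(1 - x) powr (- \<beta>) * (1 - x) powr (B - real j) = (1 - x) ^ (m - j)"
      using assms by (simp add: powr_add[symmetric] powr_realpow[symmetric])
    have b: "real (m choose j) = fact m / (fact j * fact (m - j))"
      using j by (simp add: binomial_fact)
    have "x powr (- \<alpha> - real k - 1) * (1 - x) powr (- \<beta>) / fact m * (real (m choose j) * u (m - j) x * v j x) =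
      (x powr (- \<alpha> - real k - 1) * x powr (A - real (m - j))) * ((1 - x) powr (- \<beta>) * (1 - x) powr (B - real j)) *
      (- 1) ^ j * (A gchoose (m - j)) * (B gchoose j)"
      unfolding u_def v_def falling_fact_gbinomial b by simp
    also have "\<dots> = x ^ k * ((- 1) ^ j * (A gchoose (m - j)) * (B gchoose j) * (x ^ j * (1 - x) ^ (m - j)))"
      unfolding p1 p2 by simp
    finally show "x powr (- \<alpha> - real k - 1) * (1 - x) powr (- \<beta>) / fact m * (real (m choose j) * u (m - j) x * v j x) = \<dots>" .
  qed simp
  finally show ?thesis
    unfolding m_def[symmetric] poly_sjacobi AB by (simp add: sum_distrib_left)
qed

section \<open>Moments\<close>

text \<open>Integrability and value in one statement, in the form to which
  \<open>set_integrable\<close> and \<open>LBINT\<close> unfold.\<close>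

abbreviation (input) has_integral01 :: "(real \<Rightarrow> real) \<Rightarrow> real \<Rightarrow> bool" where
  "has_integral01 f I \<equiv> has_bochner_integral lborel (\<lambda>x. indicator {0<..<1} x *\<^sub>R f x) I"

lemma has_integral01_cong:
  assumes "\<And>x. 0 < x \<Longrightarrow> x < 1 \<Longrightarrow> f x = g x"
  shows "has_integral01 f I \<longleftrightarrow> has_integral01 g I"
  by (intro has_bochner_integral_cong) (auto simp: indicator_def assms)

lemma has_integral01_mult:
  assumes "has_integral01 f I"
  shows "has_integral01 (\<lambda>x. c * f x) (c * I)"
proof -
  have "has_bochner_integral lborel (\<lambda>x. c * (indicator {0<..<1} x *\<^sub>R f x)) (c * I)"
    using assms by (rule has_bochner_integral_mult_right)
  thus ?thesis by (simp add: mult_ac)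
qed

lemma has_integral01_sum:
  assumes "\<And>i. i \<in> A \<Longrightarrow> has_integral01 (f i) (I i)"
  shows "has_integral01 (\<lambda>x. \<Sum>i\<in>A. f i x) (\<Sum>i\<in>A. I i)"
  using has_bochner_integral_sum[of A, OF assms] by (simp add: sum_distrib_left)

text \<open>The Beta integral is first a gauge integral; nonnegativity of the integrand carries it
  over to the Lebesgue integral.\<close>

lemma has_integral01_Beta:
  assumes "a > 0" "b > 0"
  shows "has_integral01 (\<lambda>x. x powr (a - 1) * (1 - x) powr (b - 1)) (Beta a b)"
proof -
  let ?f = "\<lambda>x::real. indicator {0<..<1} x *\<^sub>R (x powr (a - 1) * (1 - x) powr (b - 1))"
  have "((\<lambda>x. x powr (a - 1) * (1 - x) powr (b - 1)) has_integral Beta a b) {0<..<1}"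
    using has_integral_Beta_real[OF assms] by (simp add: has_integral_Icc_iff_Ioo)
  hence "((\<lambda>x. if x \<in> {0<..<1} then x powr (a - 1) * (1 - x) powr (b - 1) else 0) has_integral Beta a b) UNIV"
    by (simp only: has_integral_restrict_UNIV)
  also have "(\<lambda>x. if x \<in> {0<..<1} then x powr (a - 1) * (1 - x) powr (b - 1) else 0) = ?f"
    by (auto simp: indicator_def)
  finally have "(?f has_integral Beta a b) UNIV" .
  hence "(\<integral>\<^sup>+x. ?f x \<partial>lborel) = Beta a b"
    by (intro nn_integral_has_integral_lborel) (auto simp: indicator_def)
  moreover have "Beta a b \<ge> 0"
    using assms by (simp add: Beta_def)
  ultimately show ?thesis
    by (intro has_bochner_integral_nn_integral) (auto simp: indicator_def)
qed

text \<open>In terms of Gamma, the binomial replaces \<open>Gamma t\<close> by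
  \<open>Gamma (t + j)\<close>, where \<open>t + j = b + m + 1\<close>, and the sum of the Beta
  arguments is free of \<open>j\<close>. What still depends on \<open>j\<close> is a binomial in
  \<open>- s\<close>, ready for Vandermonde.\<close>

lemma gbinomial_mult_Beta:
  fixes s b :: real
  assumes "s > 0" "b > - 1" "j \<le> m"
  shows "((b + real m) gchoose j) * Beta (s + real j) (b + real (m - j) + 1) =
    (- 1) ^ j * ((- s) gchoose j) * Beta s (b + real m + 1)"
proof -
  define t where "t = b + real (m - j) + 1"
  have t: "t > 0" "b + real m + 1 = t + real j" "b + real m - real j + 1 = t"
    using assms by (auto simp: t_def of_nat_diff)
  have nonpos: "x \<notin> \<int>\<^sub>\<le>\<^sub>0" if "x > 0" for x :: real
    using that by (auto elim!: nonpos_Ints_cases)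
  have 1: "(b + real m) gchoose j = Gamma (t + real j) / Gamma t / fact j"
    using t by (subst gbinomial_pochhammer') (simp add: pochhammer_Gamma nonpos)
  have 2: "(- 1) ^ j * ((- s) gchoose j) = Gamma (s + real j) / Gamma s / fact j"
    using assms by (simp add: gbinomial_pochhammer pochhammer_Gamma nonpos flip: power_mult_distrib mult.assoc)
  have "Gamma t > 0" "Gamma s > 0"
    using t assms by auto
  thus ?thesis
    unfolding t(2) t_def[symmetric] Beta_def 1 2 by (simp add: add_ac)
qed

text \<open>The binomial factor is zero for \<open>s = a + 1, ..., a + m\<close>, which is
  orthogonality to the powers below \<open>m\<close> under the weight x^a (1 - x)^b.\<close>

lemma sjacobi_moment:
  assumes "s > 0" "b > - 1"
  shows "has_integral01 (\<lambda>x. poly (sjacobi a b m) x * (x powr (s - 1) * (1 - x) powr b))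
    (((a + real m - s) gchoose m) * Beta s (b + real m + 1))"
proof -
  let ?c = "\<lambda>j. (- 1) ^ j * ((a + real m) gchoose (m - j)) * ((b + real m) gchoose j)"
  have "has_integral01 (\<lambda>x. \<Sum>j\<le>m. ?c j * (x powr (s + real j - 1) * (1 - x) powr (b + real (m - j) + 1 - 1)))
      (\<Sum>j\<le>m. ?c j * Beta (s + real j) (b + real (m - j) + 1))"
    using assms by (intro has_integral01_sum has_integral01_mult has_integral01_Beta) auto
  also have "(\<Sum>j\<le>m. ?c j * Beta (s + real j) (b + real (m - j) + 1)) =
      (\<Sum>j\<le>m. ((- s) gchoose j) * ((a + real m) gchoose (m - j)) * Beta s (b + real m + 1))"
  proof (rule sum.cong)
    fix j assume "j \<in> {..m}"
    hence "?c j * Beta (s + real j) (b + real (m - j) + 1) = (- 1) ^ j * ((a + real m) gchoose (m - j)) *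
        ((- 1) ^ j * ((- s) gchoose j) * Beta s (b + real m + 1))"
      using gbinomial_mult_Beta[OF assms, of j m] by simp
    \<comment> \<open>The sign from \<open>sjacobi\<close> cancels the one from the Beta
      quotient.\<close>
    also have "\<dots> = ((- 1) ^ j * (- 1) ^ j) * (((- s) gchoose j) * ((a + real m) gchoose (m - j)) * Beta s (b + real m + 1))"
      by (simp only: mult_ac)
    finally show "?c j * Beta (s + real j) (b + real (m - j) + 1) =
        ((- s) gchoose j) * ((a + real m) gchoose (m - j)) * Beta s (b + real m + 1)"
      by (simp flip: power_mult_distrib)
  qed simp
  also have "\<dots> = ((a + real m - s) gchoose m) * Beta s (b + real m + 1)"
    using gbinomial_Vandermonde[of "- s" "a + real m" m] by (simp add: sum_distrib_right[symmetric] atMost_atLeast0)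
  also have "has_integral01 (\<lambda>x. \<Sum>j\<le>m. ?c j * (x powr (s + real j - 1) * (1 - x) powr (b + real (m - j) + 1 - 1))) \<dots> \<longleftrightarrow>
     has_integral01 (\<lambda>x. poly (sjacobi a b m) x * (x powr (s - 1) * (1 - x) powr b)) \<dots>"
  proof (rule has_integral01_cong)
    fix x :: real assume x: "0 < x" "x < 1"
    have 1: "x powr (s + real j - 1) = x ^ j * x powr (s - 1)" for j
      using x by (simp add: powr_realpow[symmetric] powr_add[symmetric] algebra_simps)
    have 2: "(1 - x) powr (b + real i + 1 - 1) = (1 - x) ^ i * (1 - x) powr b" for i
      using x by (simp add: powr_realpow[symmetric] powr_add[symmetric] algebra_simps)
    show "(\<Sum>j\<le>m. ?c j * (x powr (s + real j - 1) * (1 - x) powr (b + real (m - j) + 1 - 1))) =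
        poly (sjacobi a b m) x * (x powr (s - 1) * (1 - x) powr b)"
      unfolding poly_sjacobi sum_distrib_right 1 2 by (simp add: mult_ac)
  qed
  finally show ?thesis .
qed

section \<open>Moments and products of the T-kind polynomials under their weight\<close>

abbreviation (input) weight :: "real \<Rightarrow> real" where
  "weight x \<equiv> x * sqrt (x * (1 - x))"

text \<open>These exponents are the parameters \<alpha> and \<beta> of
  \<open>T_poly\<close>.\<close>

lemma inverse_weight:
  assumes "0 < x" "x < 1"
  shows "1 / weight x = x powr (- 3 / 2) * (1 - x) powr (- 1 / 2)"
proof -
  have "weight x = x powr (1 + 1 / 2) * (1 - x) powr (1 / 2)"
    using assms by (simp only: powr_add) (simp add: real_sqrt_mult powr_half_sqrt)
  thus ?thesis using assms by (simp add: powr_minus field_simps)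
qed

lemma T_poly_eq_sjacobi:
  assumes "k \<le> n" "0 < x" "x < 1"
  shows "T_poly n k x = T_coeff n k * x ^ k * poly (sjacobi (2 * real k - 1 / 2) (- 1 / 2) (n - k)) x"
  using assms by (simp add: T_poly_def P_poly_eq_sjacobi algebra_simps)

text \<open>The case \<open>s = k + i - 1 / 2\<close> of \<open>sjacobi_moment\<close>: the upper
  entry of the binomial becomes the natural number \<open>n - i\<close>. The condition
  \<open>k + i \<ge> 1\<close> makes \<open>s\<close> positive, as integrability at 0
  requires.\<close>

lemma T_poly_moment:
  assumes "k \<le> n" "i \<le> n" "k + i \<ge> 1"
  shows "has_integral01 (\<lambda>x. T_poly n k x * x ^ i / weight x)
    (T_coeff n k * (real ((n - i) choose (n - k)) * Beta (real (k + i) - 1 / 2) (real (n - k) + 1 / 2)))"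
proof -
  let ?J = "sjacobi (2 * real k - 1 / 2) (- 1 / 2) (n - k)"
  let ?s = "real (k + i) - 1 / 2"
  have "real (k + i) \<ge> 1" using assms(3) by linarith
  hence s: "?s > 0" by simp
  have "2 * real k - 1 / 2 + real (n - k) - ?s = real (n - i)"
    using assms by (simp add: of_nat_diff)
  moreover have "(- 1 / 2 :: real) + real (n - k) + 1 = real (n - k) + 1 / 2" by simp
  moreover have "(- 1 / 2 :: real) > - 1" by simp
  ultimately have "has_integral01 (\<lambda>x. poly ?J x * (x powr (?s - 1) * (1 - x) powr (- 1 / 2)))
      (real ((n - i) choose (n - k)) * Beta ?s (real (n - k) + 1 / 2))"
    using sjacobi_moment[OF s, of "- 1 / 2" "2 * real k - 1 / 2" "n - k"] by (simp only: binomial_gbinomial)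
  hence "has_integral01 (\<lambda>x. T_coeff n k * (poly ?J x * (x powr (?s - 1) * (1 - x) powr (- 1 / 2))))
      (T_coeff n k * (real ((n - i) choose (n - k)) * Beta ?s (real (n - k) + 1 / 2)))"
    by (rule has_integral01_mult)
  also have "?this \<longleftrightarrow> ?thesis"
  proof (rule has_integral01_cong)
    fix x :: real assume x: "0 < x" "x < 1"
    have "x powr (?s - 1) = x powr (real (k + i) + (- 3 / 2))" by (simp add: algebra_simps)
    also have "\<dots> = x ^ k * x ^ i * x powr (- 3 / 2)"
      by (simp only: powr_add powr_realpow[OF x(1)] power_add)
    finally have p: "x powr (?s - 1) = x ^ k * x ^ i * x powr (- 3 / 2)" .
    have "T_poly n k x * x ^ i / weight x = T_poly n k x * x ^ i * (1 / weight x)" by simp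
    also have "\<dots> = T_coeff n k * (poly ?J x * (x powr (?s - 1) * (1 - x) powr (- 1 / 2)))"
      by (simp only: inverse_weight[OF x] T_poly_eq_sjacobi[OF assms(1) x] p mult_ac)
    finally show "T_coeff n k * (poly ?J x * (x powr (?s - 1) * (1 - x) powr (- 1 / 2))) =
        T_poly n k x * x ^ i / weight x" ..
  qed
  finally show ?thesis .
qed

text \<open>Only the factor with the larger index is expanded in powers: these start at
  \<open>l \<ge> k\<close>, while moments of \<open>T_poly n k\<close> vanish beyond
  \<open>k\<close>.\<close>

lemma T_poly_product_integral:
  assumes "k \<le> l" "l \<le> n" "1 \<le> l"
  shows "has_integral01 (\<lambda>x. T_poly n k x * T_poly n l x / weight x)
    (if k = l then (T_coeff n k)\<^sup>2 * ((real (n + k) - 1 / 2) gchoose (n - k)) *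
       Beta (2 * real k - 1 / 2) (real (n - k) + 1 / 2) else 0)"
proof -
  let ?J = "sjacobi (2 * real l - 1 / 2) (- 1 / 2) (n - l)"
  let ?M = "\<lambda>i. T_coeff n k * (real ((n - i) choose (n - k)) * Beta (real (k + i) - 1 / 2) (real (n - k) + 1 / 2))"
  have "has_integral01 (\<lambda>x. \<Sum>j\<le>n - l. T_coeff n l * coeff ?J j * (T_poly n k x * x ^ (l + j) / weight x))
      (\<Sum>j\<le>n - l. T_coeff n l * coeff ?J j * ?M (l + j))"
    using assms by (intro has_integral01_sum has_integral01_mult T_poly_moment) auto
  also have "?this \<longleftrightarrow> has_integral01 (\<lambda>x. T_poly n k x * T_poly n l x / weight x)
      (\<Sum>j\<le>n - l. T_coeff n l * coeff ?J j * ?M (l + j))"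
  proof (rule has_integral01_cong)
    fix x :: real assume x: "0 < x" "x < 1"
    \<comment> \<open>Summing up to the degree bound \<open>n - l\<close> avoids determining the
      exact degree.\<close>
    have "poly ?J x = (\<Sum>j\<le>n - l. coeff ?J j * x ^ j)"
      unfolding poly_altdef by (rule sum.mono_neutral_left) (auto simp: coeff_eq_0 degree_sjacobi)
    thus "(\<Sum>j\<le>n - l. T_coeff n l * coeff ?J j * (T_poly n k x * x ^ (l + j) / weight x)) =
        T_poly n k x * T_poly n l x / weight x"
      using T_poly_eq_sjacobi[of l n x] x assms
      by (simp add: sum_distrib_left sum_distrib_right sum_divide_distrib power_add mult_ac)
  qed
  \<comment> \<open>For \<open>j > 0\<close> the binomial has \<open>n - (l + j) < n - k\<close>, so
    it is zero.\<close>
  also have "(\<Sum>j\<le>n - l. T_coeff n l * coeff ?J j * ?M (l + j)) =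
      (\<Sum>j\<le>n - l. if j = 0 then T_coeff n l * coeff ?J 0 * ?M l else 0)"
    using assms by (intro sum.cong) (auto simp: binomial_eq_0)
  also have "\<dots> = T_coeff n l * coeff ?J 0 * ?M l" by simp
  also have "\<dots> = (if k = l then (T_coeff n k)\<^sup>2 * ((real (n + k) - 1 / 2) gchoose (n - k)) *
       Beta (2 * real k - 1 / 2) (real (n - k) + 1 / 2) else 0)"
  proof (cases "k = l")
    case True
    have "2 * real l - 1 / 2 + real (n - l) = real (n + l) - 1 / 2" "real (l + l) = 2 * real l"
      using assms by (auto simp: of_nat_diff)
    thus ?thesis using True by (simp only: coeff_0_sjacobi) (simp add: power2_eq_square)
  next
    case False
    hence "n - l < n - k" using assms by linarith
    thus ?thesis using False by (simp add: binomial_eq_0)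
  qed
  finally show ?thesis .
qed

section \<open>Evaluation of the constants\<close>

lemma Gamma_nat_plus_half: "Gamma (real m + 1 / 2) = pochhammer (1 / 2) m * sqrt pi"
proof -
  have "(1 / 2 :: real) \<notin> \<int>\<^sub>\<le>\<^sub>0" by (auto elim!: nonpos_Ints_cases)
  hence "pochhammer (1 / 2 :: real) m = Gamma (1 / 2 + real m) / sqrt pi"
    by (simp add: pochhammer_Gamma Gamma_one_half_real)
  thus ?thesis by (simp add: add.commute)
qed

text \<open>Read backwards, the falling factorial from \<open>n - k - 1 / 2\<close> is the rising
  one from \<open>1 / 2\<close>, the common currency of all the constants below.\<close>

lemma T_coeff_eq:
  assumes "k \<le> n"
  shows "T_coeff n k = fact (n - k) / pochhammer (1 / 2) (n - k)"
  using assms by (simp add: T_coeff_def falling_fact_gbinomial gbinomial_pochhammer' of_nat_diff)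

lemma double_fact_even: "double_fact (2 * int m) = 2 ^ m * fact m"
  by (induction m) (subst double_fact.simps; simp add: algebra_simps)+

text \<open>The case \<open>m = 0\<close> is the convention (-1)!! = 1, which occurs below for
  \<open>k = n\<close> in the norm and for \<open>k = 1\<close> in the mean.\<close>

lemma double_fact_odd: "double_fact (2 * int m - 1) = 2 ^ m * pochhammer (1 / 2) m"
  by (induction m) (subst double_fact.simps; simp add: pochhammer_Suc algebra_simps)+

text \<open>\<open>Gamma a\<close> cancels between the binomial and the Beta value, leaving
  \<open>1 / a\<close>, one quotient in \<open>m\<close> and one in \<open>N\<close>; these match
  the three factors on the right.\<close>

lemma T_poly_norm_eval:
  assumes "1 \<le> k" "k \<le> n"
  shows "(T_coeff n k)\<^sup>2 * ((real (n + k) - 1 / 2) gchoose (n - k)) *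
      Beta (2 * real k - 1 / 2) (real (n - k) + 1 / 2) =
    1 / (2 * (real k + real k) - 1) *
      (double_fact (2 * int n - int k - int k) / double_fact (2 * int n - int k - int k - 1)) *
      (double_fact (2 * int n + int k + int k - 1) / double_fact (2 * int n + int k + int k - 2)) * pi"
proof -
  define m N a p where "m = n - k" and "N = n + k" and "a = 2 * real k - 1 / 2" and
    "p = (pochhammer (1 / 2) m :: real)"
  have a: "a > 0" and p: "p > 0" using assms by (auto simp: a_def p_def intro!: pochhammer_pos)
  have N: "N > 0" using assms by (simp add: N_def)
  have 1: "a + real m + 1 = real N + 1 / 2" "real N - 1 / 2 - real m + 1 = a + 1" "a + (real m + 1 / 2) = real N"
    using assms by (auto simp: a_def m_def N_def of_nat_diff)
  have "a \<notin> \<int>\<^sub>\<le>\<^sub>0" "a + 1 \<notin> \<int>\<^sub>\<le>\<^sub>0" using a by (auto elim!: nonpos_Ints_cases)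
  hence Ga: "Gamma (a + 1) = a * Gamma a" and
      "pochhammer (a + 1) m = Gamma (a + 1 + real m) / Gamma (a + 1)"
    by (auto simp: Gamma_plus1 pochhammer_Gamma)
  hence g: "(real N - 1 / 2) gchoose m = Gamma (real N + 1 / 2) / (a * Gamma a) / fact m"
    unfolding gbinomial_pochhammer' 1(2) 1(1)[symmetric] by (simp add: add_ac)
  have B: "Beta a (real m + 1 / 2) = Gamma a * (p * sqrt pi) / fact (N - 1)"
    unfolding Beta_def 1(3) Gamma_nat_plus_half p_def using N Gamma_fact[of "N - 1", where ?'a = real]
    by (simp add: of_nat_diff)
  have G: "Gamma a \<noteq> 0" using Gamma_real_pos[OF a] by simp
  \<comment> \<open>Read \<open>f\<close>, \<open>P\<close>, \<open>s\<close>, \<open>g\<close>,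
    \<open>F\<close> as \<open>fact m\<close>, \<open>pochhammer (1 / 2) N\<close>,
    \<open>sqrt pi\<close>, \<open>Gamma a\<close>, \<open>fact (N - 1)\<close>.\<close>
  have cancel: "(f / p)\<^sup>2 * (P * s / (a * g) / f) * (g * (p * s) / F) = f * P * (s * s) / (a * p * F)"
    if "g \<noteq> 0" "f \<noteq> 0" for f P s g F :: real
    using a p that by (simp add: power2_eq_square mult_ac)
  have L: "(T_coeff n k)\<^sup>2 * ((real N - 1 / 2) gchoose m) * Beta a (real m + 1 / 2) =
      fact m * pochhammer (1 / 2) N * pi / (a * p * fact (N - 1))"
    unfolding T_coeff_eq[OF assms(2)] m_def[symmetric] p_def[symmetric] g B Gamma_nat_plus_half
    by (subst cancel[OF G]) simp_all
  have i: "2 * int n - int k - int k = 2 * int m" "2 * int n - int k - int k - 1 = 2 * int m - 1"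
     "2 * int n + int k + int k - 1 = 2 * int N - 1" "2 * int n + int k + int k - 2 = 2 * int (N - 1)"
    using assms by (auto simp: m_def N_def of_nat_diff)
  \<comment> \<open>The surplus factor 2 in (2N - 1)!! / (2N - 2)!! turns \<open>1 / (2 * a)\<close>
    into \<open>1 / a\<close>.\<close>
  have "2 ^ N = (2::real) * 2 ^ (N - 1)" using N by (cases N) auto
  moreover have "2 * (real k + real k) - 1 = 2 * a" by (simp add: a_def)
  ultimately show ?thesis
    unfolding m_def[symmetric] N_def[symmetric] a_def[symmetric] L i double_fact_even double_fact_odd p_def[symmetric]
    using a p by (simp add: field_simps)
qed

text \<open>Both Beta arguments are half-integers with sum \<open>n\<close>, so the two Gamma values
  contribute the factor \<open>pi\<close>, and the denominator is
  \<open>fact (n - 1)\<close>.\<close>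

lemma T_poly_mean_eval:
  assumes "1 \<le> k" "k \<le> n"
  shows "T_coeff n k * (real (n choose (n - k)) * Beta (real k - 1 / 2) (real (n - k) + 1 / 2)) =
    double_fact (2 * int k - 3) / double_fact (2 * int k) * (2 * real n * pi)"
proof -
  define m r p q where "m = n - k" and "r = k - 1" and
    "p = (pochhammer (1 / 2) m :: real)" and "q = (pochhammer (1 / 2) r :: real)"
  have p: "p > 0" by (auto simp: p_def intro!: pochhammer_pos)
  \<comment> \<open>Makes \<open>2 ^ k = 2 * 2 ^ r\<close> available, which absorbs the 2 of
    \<open>2 * real n\<close>.\<close>
  have k: "k = Suc r" using assms by (simp add: r_def)
  have 1: "real k - 1 / 2 = real r + 1 / 2" "real r + 1 / 2 + (real m + 1 / 2) = real n" "2 * int k - 3 = 2 * int r - 1"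
    using assms by (auto simp: r_def m_def of_nat_diff)
  have B: "Beta (real r + 1 / 2) (real m + 1 / 2) = q * sqrt pi * (p * sqrt pi) / fact (n - 1)"
    unfolding Beta_def 1(2) Gamma_nat_plus_half p_def q_def
    using assms Gamma_fact[of "n - 1", where ?'a = real] by (simp add: of_nat_diff)
  have C: "real (n choose m) = fact n / (fact k * fact m)"
    using assms by (simp add: m_def binomial_fact)
  have F: "fact n = real n * fact (n - 1)" using assms by (simp add: fact_reduce)
  show ?thesis
    unfolding T_coeff_eq[OF assms(2)] m_def[symmetric] 1(1,3) double_fact_even double_fact_odd B C F
      p_def[symmetric] q_def[symmetric]
    using p by (simp add: field_simps k power2_eq_square del: of_nat_Suc fact_Suc)
qed

theorem mainTheorem6:
  fixes n :: nat
  assumes "n \<ge> 1"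
  shows
    "(\<forall>k\<in>{0..n}. \<forall>l\<in>{1..n}.
        set_integrable lborel {0<..<1::real}
          (\<lambda>x. T_poly n k x * T_poly n l x / (x * sqrt (x * (1 - x)))) \<and>
        (LBINT x:{0<..<1::real}. T_poly n k x * T_poly n l x / (x * sqrt (x * (1 - x)))) =
          1 / (2 * (real k + real l) - 1) *
          (double_fact (2 * int n - int k - int l) / double_fact (2 * int n - int k - int l - 1)) *
          (double_fact (2 * int n + int k + int l - 1) / double_fact (2 * int n + int k + int l - 2)) *
          pi * (if k = l then 1 else 0)) \<and>
     (\<forall>k\<in>{1..n}.
        set_integrable lborel {0<..<1::real} (\<lambda>x. T_poly n k x / (x * sqrt (x * (1 - x)))) \<and>
        (LBINT x:{0<..<1::real}. T_poly n k x / (x * sqrt (x * (1 - x)))) =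
          double_fact (2 * int k - 3) / double_fact (2 * int k) * (2 * real n * pi))"
  unfolding set_integrable_def set_lebesgue_integral_def has_bochner_integral_iff[symmetric]
proof (intro conjI ballI)
  fix k l assume kl: "k \<in> {0..n}" "l \<in> {1..n}"
  \<comment> \<open>The product lemma wants the smaller index first; the integrand is symmetric, and
    the larger index is positive in each case.\<close>
  consider "k = l" | "k < l" | "l < k" by linarith
  thus "has_integral01 (\<lambda>x. T_poly n k x * T_poly n l x / weight x)
     (1 / (2 * (real k + real l) - 1) *
      (double_fact (2 * int n - int k - int l) / double_fact (2 * int n - int k - int l - 1)) *
      (double_fact (2 * int n + int k + int l - 1) / double_fact (2 * int n + int k + int l - 2)) *
      pi * (if k = l then 1 else 0))"
  proof cases
    case 1
    thus ?thesis using T_poly_product_integral[of k k n] T_poly_norm_eval[of k n] kl by simp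
  next
    case 2
    thus ?thesis using T_poly_product_integral[of k l n] kl by simp
  next
    case 3
    thus ?thesis using T_poly_product_integral[of l k n] kl by (simp add: mult.commute)
  qed
next
  fix k assume "k \<in> {1..n}"
  thus "has_integral01 (\<lambda>x. T_poly n k x / weight x)
      (double_fact (2 * int k - 3) / double_fact (2 * int k) * (2 * real n * pi))"
    using T_poly_moment[of k n 0] T_poly_mean_eval[of k n] by simp
qed

end
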